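(* Let $S$ be a finite non-empty set, let $p:2^S\to\mathbb{Z}\cup\{-\infty\}$ be an integer-valued supermodular function with $p(\emptyset)=0$ and $p(S)$ finite, and let $B=B'(p)$ be the integral base-polyhedron defined by $p$. Let $\lambda_1>\lambda_2>\cdots>\lambda_r$ be the critical values, $\{\hat S_1,\dots,\hat S_r\}$ the principal partition and $\hat C_1\subset\cdots\subset\hat C_r$ the principal chain of $p$; let $\beta_1>\beta_2>\cdots>\beta_q$ be the essential values, $\{S_1,\dots,S_q\}$ the canonical partition and $C_1\subset\cdots\subset C_q$ the canonical chain of $p$. Then: (1) The essential values $\beta_1>\beta_2>\cdots>\beta_q$ are precisely the distinct members of the rounded-up integers $\lceil\lambda_1\rceil\ge\lceil\lambda_2\rceil\ge\cdots\ge\lceil\lambda_r\rceil$. In particular, an integer $\beta$ is an essential value if and only if there exists a critical value $\lambda$ satisfying $\beta\ge\lambda>\beta-1$. (2) The canonical partition is an aggregation of the principal partition, given by $$S_j=\bigcup_{i\in I(j)}\hat S_i\qquad(j=1,2,\dots,q),$$ where $I(j):=\{i:\lceil\lambda_i\rceil=\beta_j\}$. (3) The canonical chain is a subchain of the principal chain: for each $j=1,\dots,q$ we have $C_j=\hat C_i$ for $i=\max I(j)$.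
   Context: For $x\in\mathbb{R}^S$ and $Z\subseteq S$, $\widetilde x(Z):=\sum_{s\in Z}x(s)$. A set-function $p$ on $S$ with $p(\emptyset)=0$ (value $-\infty$ allowed) is supermodular if $p(X)+p(Y)\le p(X\cap Y)+p(X\cup Y)$ for all $X,Y\subseteq S$ with finite $p$-values. $B'(p):=\{x\in\mathbb{R}^S:\widetilde x(S)=p(S),\ \widetilde x(Z)\ge p(Z)\text{ for every }Z\subset S\}$. Principal partition. For $\lambda\in\mathbb{R}$ let $\mathcal{L}(\lambda)$ be the family of all maximizers over $X\subseteq S$ of $p(X)-\lambda|X|$; it is closed under union and intersection, and $L(\lambda)$ denotes its smallest member. The critical values $\lambda_1>\cdots>\lambda_r$ are the (finitely many) real numbers $\lambda$ with $|\mathcal{L}(\lambda)|\ge2$; equivalently, those with $L(\lambda)\ne L(\lambda-\varepsilon)$ for every $\varepsilon>0$. With the convention $L(\lambda_{r+1}):=S$, the principal partition is $\hat S_i:=L(\lambda_{i+1})-L(\lambda_i)$ $(i=1,\dots,r)$, and the principal chain is $\hat C_i:=\hat S_1\cup\cdots\cup\hat S_i$ $(i=1,\dots,r)$. Canonical partition. Put $C_0:=\emptyset$ and, for $j=1,2,\dots$, with $\overline{C_{j-1}}:=S-C_{j-1}$, $\beta_j:=\max\{\lceil (p(X\cup C_{j-1})-p(C_{j-1}))/|X|\rceil:\emptyset\ne X\subseteq\overline{C_{j-1}}\}$, $h_j(X):=p(X\cup C_{j-1})-(\beta_j-1)|X|-p(C_{j-1})$ for $X\subseteq\overline{C_{j-1}}$,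 $S_j:=$ the smallest subset of $\overline{C_{j-1}}$ maximizing $h_j$, $C_j:=C_{j-1}\cup S_j$, stopping at the index $q$ with $C_{q-1}\ne S$, $C_q=S$. The integers $\beta_j$ are the essential values (they are strictly decreasing), $C_1\subset\cdots\subset C_q$ is the canonical chain, and $\{S_1,\dots,S_q\}$ is the canonical partition. *)

theory Defs
  imports "HOL-Library.Extended_Real" "HOL-Library.FuncSet"
begin

text \<open>Set-functions on a ground set \<open>S\<close> are functions \<open>p :: 'a set \<Rightarrow> ereal\<close>, of which only the
  values on subsets of \<open>S\<close> matter. Since \<open>p X\<close> is never \<open>\<infinity>\<close> for \<open>X \<subseteq> S\<close>,
  a value is finite iff it differs from \<open>-\<infinity>\<close>.\<close>

definition integer_valued_on :: "'a set \<Rightarrow> ('a set \<Rightarrow> ereal) \<Rightarrow> bool" where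
  "integer_valued_on S p \<longleftrightarrow> (\<forall>X\<subseteq>S. p X = -\<infinity> \<or> (\<exists>k::int. p X = ereal (of_int k)))"

definition supermodular_on :: "'a set \<Rightarrow> ('a set \<Rightarrow> ereal) \<Rightarrow> bool" where
  "supermodular_on S p \<longleftrightarrow>
     (\<forall>X Y. X \<subseteq> S \<longrightarrow> Y \<subseteq> S \<longrightarrow> p X \<noteq> -\<infinity> \<longrightarrow> p Y \<noteq> -\<infinity> \<longrightarrow>
        p X + p Y \<le> p (X \<inter> Y) + p (X \<union> Y))"

definition base_polyhedron :: "'a set \<Rightarrow> ('a set \<Rightarrow> ereal) \<Rightarrow> ('a \<Rightarrow> real) set" where
  "base_polyhedron S p =
     {x \<in> S \<rightarrow>\<^sub>E UNIV. ereal (\<Sum>s\<in>S. x s) = p S \<and>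
        (\<forall>Z. Z \<subset> S \<longrightarrow> p Z \<le> ereal (\<Sum>s\<in>Z. x s))}"

definition maximizers :: "'a set \<Rightarrow> ('a set \<Rightarrow> ereal) \<Rightarrow> 'a set set" where
  "maximizers U f = {X. X \<subseteq> U \<and> (\<forall>Y\<subseteq>U. f Y \<le> f X)}"

text \<open>\<open>LEAST\<close> on sets is taken with respect to inclusion.\<close>

definition smallest_maximizer :: "'a set \<Rightarrow> ('a set \<Rightarrow> ereal) \<Rightarrow> 'a set" where
  "smallest_maximizer U f = (LEAST X. X \<in> maximizers U f)"


subsection \<open>Principal partition\<close>

definition level_family :: "'a set \<Rightarrow> ('a set \<Rightarrow> ereal) \<Rightarrow> real \<Rightarrow> 'a set set" where
  "level_family S p l = maximizers S (\<lambda>X. p X - ereal (l * real (card X)))"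

definition level_set :: "'a set \<Rightarrow> ('a set \<Rightarrow> ereal) \<Rightarrow> real \<Rightarrow> 'a set" where
  "level_set S p l = smallest_maximizer S (\<lambda>X. p X - ereal (l * real (card X)))"

definition critical_values :: "'a set \<Rightarrow> ('a set \<Rightarrow> ereal) \<Rightarrow> real set" where
  "critical_values S p = {l. card (level_family S p l) \<ge> 2}"

definition num_critical :: "'a set \<Rightarrow> ('a set \<Rightarrow> ereal) \<Rightarrow> nat" where
  "num_critical S p = card (critical_values S p)"

text \<open>The \<open>i\<close>-th largest critical value, for \<open>i = 1, \<dots>, num_critical S p\<close>.\<close>

definition critical_value :: "'a set \<Rightarrow> ('a set \<Rightarrow> ereal) \<Rightarrow> nat \<Rightarrow> real" where
  "critical_value S p i = rev (sorted_list_of_set (critical_values S p)) ! (i - 1)"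

text \<open>\<open>L(\<lambda>\<^sub>i)\<close>, with the convention that it is \<open>S\<close> for \<open>i = num_critical S p + 1\<close>.\<close>

definition critical_level_set :: "'a set \<Rightarrow> ('a set \<Rightarrow> ereal) \<Rightarrow> nat \<Rightarrow> 'a set" where
  "critical_level_set S p i =
     (if i \<le> num_critical S p then level_set S p (critical_value S p i) else S)"

definition principal_part :: "'a set \<Rightarrow> ('a set \<Rightarrow> ereal) \<Rightarrow> nat \<Rightarrow> 'a set" where
  "principal_part S p i = critical_level_set S p (i + 1) - critical_level_set S p i"

definition principal_chain :: "'a set \<Rightarrow> ('a set \<Rightarrow> ereal) \<Rightarrow> nat \<Rightarrow> 'a set" where
  "principal_chain S p i = (\<Union>k\<in>{1..i}. principal_part S p k)"


subsection \<open>Canonical partition\<close>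

text \<open>The next two functions describe one step of the construction, from the chain member
  \<open>C = C\<^bsub>j-1\<^esub>\<close>. Sets \<open>X\<close> with \<open>p (X \<union> C) = -\<infinity>\<close> contribute \<open>-\<infinity>\<close> to
  the maximum defining \<open>\<beta>\<^sub>j\<close> and are therefore left out of it; \<open>X = S - C\<close> always
  remains, as \<open>p S\<close> is finite.\<close>

definition step_value :: "'a set \<Rightarrow> ('a set \<Rightarrow> ereal) \<Rightarrow> 'a set \<Rightarrow> int" where
  "step_value S p C =
     Max {\<lceil>real_of_ereal (p (X \<union> C) - p C) / real (card X)\<rceil> | X.
            X \<noteq> {} \<and> X \<subseteq> S - C \<and> p (X \<union> C) \<noteq> -\<infinity>}"

definition step_part :: "'a set \<Rightarrow> ('a set \<Rightarrow> ereal) \<Rightarrow> 'a set \<Rightarrow> 'a set" where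
  "step_part S p C =
     smallest_maximizer (S - C)
       (\<lambda>X. p (X \<union> C) - ereal (of_int (step_value S p C - 1) * real (card X)) - p C)"

primrec canonical_chain :: "'a set \<Rightarrow> ('a set \<Rightarrow> ereal) \<Rightarrow> nat \<Rightarrow> 'a set" where
  "canonical_chain S p 0 = {}"
| "canonical_chain S p (Suc j) =
     canonical_chain S p j \<union> step_part S p (canonical_chain S p j)"

text \<open>Both are meant for \<open>j \<ge> 1\<close>.\<close>

definition essential_value :: "'a set \<Rightarrow> ('a set \<Rightarrow> ereal) \<Rightarrow> nat \<Rightarrow> int" where
  "essential_value S p j = step_value S p (canonical_chain S p (j - 1))"

definition canonical_part :: "'a set \<Rightarrow> ('a set \<Rightarrow> ereal) \<Rightarrow> nat \<Rightarrow> 'a set" where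
  "canonical_part S p j = step_part S p (canonical_chain S p (j - 1))"

text \<open>The stopping index \<open>q\<close>; here \<open>C\<^bsub>q-1\<^esub> \<noteq> S\<close> by minimality, since \<open>S \<noteq> {}\<close>.\<close>

definition num_essential :: "'a set \<Rightarrow> ('a set \<Rightarrow> ereal) \<Rightarrow> nat" where
  "num_essential S p = (LEAST q. canonical_chain S p q = S)"

definition aggregation_indices :: "'a set \<Rightarrow> ('a set \<Rightarrow> ereal) \<Rightarrow> nat \<Rightarrow> nat set" where
  "aggregation_indices S p j =
     {i \<in> {1..num_critical S p}. \<lceil>critical_value S p i\<rceil> = essential_value S p j}"

end

theory Submission
  imports Defs
begin

text \<open>Write \<open>L(\<lambda>)\<close> for the smallest maximizer of \<open>p(X) - \<lambda>|X|\<close>. As \<open>\<lambda>\<close> decreases, \<open>L\<close> grows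
  from \<open>{}\<close> to \<open>S\<close>, and both partitions read off the jumps of this one set-valued step function:
  the principal partition looks at all real \<open>\<lambda>\<close>, the canonical partition at integers only.

  Supermodularity gives the nesting property \<open>maxims_nested\<close>: every maximizer for \<open>\<lambda>\<close> is contained in
  every maximizer for any \<open>\<mu> < \<lambda>\<close>. It yields \<open>jump_iff_critical\<close>: for \<open>a \<le> b\<close> the sets \<open>L(a)\<close> and \<open>L(b)\<close> differ iff
  some critical value lies in the half-open interval from \<open>a\<close> (excluded) to \<open>b\<close> (included). On the principal side, the
  parts telescope, and \<open>L(\<lambda>)\<close> is the member of the principal chain whose index is the number of
  critical values above \<open>\<lambda>\<close> (\<open>least_max_eq_principal_chain\<close>).

  On the canonical side, suppose \<open>C = L(b)\<close> for an integer \<open>b\<close>. Clearing denominators, the step value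
  at \<open>C\<close> is at most \<open>k\<close> iff \<open>C\<close> is optimal for \<open>k\<close> among its supersets. For \<open>k \<le> b\<close> the restriction to supersets
  is harmless by nesting, so this says \<open>L(k) = C\<close>. The step value is thus the least integer \<open>\<beta>\<close> with
  \<open>L(\<beta>) = C\<close>, and the next chain member is \<open>L(\<beta> - 1)\<close>, which is strictly larger (\<open>canonical_step\<close>). By
  induction \<open>C\<^sub>j = L(\<beta>\<^sub>j - 1)\<close> and \<open>C\<^bsub>j-1\<^esub> = L(\<beta>\<^sub>j)\<close>, so the essential values are exactly the integers \<open>b\<close> with
  \<open>L(b - 1) \<noteq> L(b)\<close> (\<open>essential_value_iff_jump\<close>), that is, the rounded-up critical values.

  Comparing both descriptions of \<open>L(\<beta>\<^sub>j)\<close> and \<open>L(\<beta>\<^sub>j - 1)\<close> as members of the principal chain identifies the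
  canonical chain, and taking differences the canonical parts: the principal parts between the two
  indices are those whose critical value rounds up to \<open>\<beta>\<^sub>j\<close>.\<close>

section \<open>Maximizers of the penalized function\<close>

locale integral_supermodular =
  fixes S :: "'a set" and p :: "'a set \<Rightarrow> ereal"
  assumes finite_S: "finite S"
    and integral: "integer_valued_on S p"
    and supermodular: "supermodular_on S p"
    and p_empty: "p {} = 0"
    and p_S: "p S \<noteq> -\<infinity>"
begin

definition finite_sets :: "'a set set" where
  "finite_sets = {X. X \<subseteq> S \<and> p X \<noteq> -\<infinity>}"

definition val :: "'a set \<Rightarrow> real" where
  "val X = real_of_ereal (p X)"

definition gain :: "real \<Rightarrow> 'a set \<Rightarrow> real" where
  "gain l X = val X - l * real (card X)"

abbreviation maxims :: "real \<Rightarrow> 'a set set" where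
  "maxims l \<equiv> level_family S p l"

abbreviation least_max :: "real \<Rightarrow> 'a set" where
  "least_max l \<equiv> level_set S p l"

abbreviation crit :: "real set" where
  "crit \<equiv> critical_values S p"

lemma p_eq_val: "X \<in> finite_sets \<Longrightarrow> p X = ereal (val X)"
  using integral by (auto simp: finite_sets_def val_def integer_valued_on_def)

lemma finite_finite_sets: "finite finite_sets"
  using finite_S by (auto simp: finite_sets_def)

lemma finite_sets_subset: "X \<in> finite_sets \<Longrightarrow> X \<subseteq> S"
  by (simp add: finite_sets_def)

lemma finite_sets_finite: "X \<in> finite_sets \<Longrightarrow> finite X"
  using finite_S finite_sets_subset finite_subset by blast

lemma empty_in_finite_sets: "{} \<in> finite_sets"
  using p_empty by (simp add: finite_sets_def)

lemma S_in_finite_sets: "S \<in> finite_sets"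
  using p_S by (simp add: finite_sets_def)

lemma val_empty: "val {} = 0"
  by (simp add: val_def p_empty)

lemma not_PInf: "X \<subseteq> S \<Longrightarrow> p X \<noteq> \<infinity>"
  using integral by (auto simp: integer_valued_on_def)

text \<open>No value is \<open>\<infinity>\<close>, so a finite lower bound on \<open>p(X \<inter> Y) + p(X \<union> Y)\<close> forces both terms to be finite.
  Hence the sets of finite value form a lattice, on which \<open>val\<close> is a real supermodular function.\<close>

lemma finite_sets_Int_Un:
  assumes "X \<in> finite_sets" "Y \<in> finite_sets"
  shows "X \<inter> Y \<in> finite_sets" "X \<union> Y \<in> finite_sets"
    "val X + val Y \<le> val (X \<inter> Y) + val (X \<union> Y)"
proof -
  have sub: "X \<inter> Y \<subseteq> S" "X \<union> Y \<subseteq> S" using assms by (auto simp: finite_sets_def)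
  have "p X + p Y \<le> p (X \<inter> Y) + p (X \<union> Y)"
    using supermodular assms by (auto simp: supermodular_on_def finite_sets_def)
  then have *: "ereal (val X + val Y) \<le> p (X \<inter> Y) + p (X \<union> Y)"
    using assms by (simp add: p_eq_val)
  then have "p (X \<inter> Y) \<noteq> -\<infinity>" "p (X \<union> Y) \<noteq> -\<infinity>"
    using not_PInf[OF sub(1)] not_PInf[OF sub(2)]
    by (cases "p (X \<inter> Y)"; cases "p (X \<union> Y)"; auto)+
  then show a: "X \<inter> Y \<in> finite_sets" and b: "X \<union> Y \<in> finite_sets"
    using sub by (auto simp: finite_sets_def)
  show "val X + val Y \<le> val (X \<inter> Y) + val (X \<union> Y)"
    using * by (simp add: p_eq_val[OF a] p_eq_val[OF b])
qed

text \<open>The empty set has finite value, so a maximizer has finite value as well. From here on the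
  argument takes place in the reals.\<close>

lemma maxims_iff:
  "X \<in> maxims l \<longleftrightarrow> X \<in> finite_sets \<and> (\<forall>Y\<in>finite_sets. gain l Y \<le> gain l X)"
    (is "?lhs \<longleftrightarrow> ?rhs")
proof
  assume L: ?lhs
  then have X: "X \<subseteq> S"
    and le: "\<And>Y. Y \<subseteq> S \<Longrightarrow> p Y - ereal (l * card Y) \<le> p X - ereal (l * card X)"
    by (auto simp: level_family_def maximizers_def)
  have "p X \<noteq> -\<infinity>" using le[of "{}"] by (auto simp: p_empty)
  then have XF: "X \<in> finite_sets" using X by (simp add: finite_sets_def)
  moreover have "gain l Y \<le> gain l X" if "Y \<in> finite_sets" for Y
    using le[OF finite_sets_subset[OF that]] by (simp add: p_eq_val[OF that] p_eq_val[OF XF] gain_def)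
  ultimately show ?rhs by blast
next
  assume R: ?rhs
  then have XF: "X \<in> finite_sets" by blast
  have "p Y - ereal (l * card Y) \<le> p X - ereal (l * card X)" if "Y \<subseteq> S" for Y
  proof (cases "Y \<in> finite_sets")
    case True
    then show ?thesis using R by (simp add: p_eq_val[OF True] p_eq_val[OF XF] gain_def)
  next
    case False
    then show ?thesis using that by (simp add: finite_sets_def)
  qed
  then show ?lhs using finite_sets_subset[OF XF] by (auto simp: level_family_def maximizers_def)
qed

lemma gain_supermodular:
  assumes "X \<in> finite_sets" "Y \<in> finite_sets"
  shows "gain l X + gain l Y \<le> gain l (X \<inter> Y) + gain l (X \<union> Y)"
proof -
  have "card X + card Y = card (X \<inter> Y) + card (X \<union> Y)"
    using card_Un_Int[of X Y] assms finite_sets_finite by simp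
  then have "real (card X) + real (card Y) = real (card (X \<inter> Y)) + real (card (X \<union> Y))"
    by linarith
  then have "l * real (card X) + l * real (card Y)
      = l * real (card (X \<inter> Y)) + l * real (card (X \<union> Y))"
    by (metis distrib_left)
  then show ?thesis using finite_sets_Int_Un(3)[OF assms] by (simp add: gain_def)
qed

lemma maxims_Int:
  assumes "X \<in> maxims l" "Y \<in> maxims l"
  shows "X \<inter> Y \<in> maxims l"
proof -
  have F: "X \<in> finite_sets" "Y \<in> finite_sets" using assms by (auto simp: maxims_iff)
  have "gain l (X \<union> Y) \<le> gain l Y"
    using assms finite_sets_Int_Un(2)[OF F] by (simp add: maxims_iff)
  then have "gain l X \<le> gain l (X \<inter> Y)" using gain_supermodular[OF F, of l] by linarith
  then show ?thesis using assms(1) finite_sets_Int_Un(1)[OF F]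
    unfolding maxims_iff by (meson order_trans)
qed

lemma maxims_nonempty: "maxims l \<noteq> {}"
proof -
  obtain X where "X \<in> finite_sets" "\<forall>Y\<in>finite_sets. gain l Y \<le> gain l X"
    using ex_is_arg_min_if_finite[OF finite_finite_sets, of "\<lambda>X. - gain l X"]
      empty_in_finite_sets by (auto simp: is_arg_min_linorder)
  then show ?thesis using maxims_iff by blast
qed

lemma finite_maxims: "finite (maxims l)"
  by (rule finite_subset[OF _ finite_finite_sets]) (auto simp: maxims_iff)

lemma least_max_in: "least_max l \<in> maxims l"
  and least_max_subset: "X \<in> maxims l \<Longrightarrow> least_max l \<subseteq> X"
proof -
  have closed: "\<Inter>A \<in> maxims l" if "finite A" "A \<noteq> {}" "A \<subseteq> maxims l" for A
    using that by (induction rule: finite_ne_induct) (auto intro: maxims_Int)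
  have I: "\<Inter>(maxims l) \<in> maxims l"
    by (rule closed[OF finite_maxims maxims_nonempty order_refl])
  have "least_max l = \<Inter>(maxims l)"
    unfolding level_set_def smallest_maximizer_def level_family_def[symmetric]
    by (rule Least_equality) (use I in auto)
  then show "least_max l \<in> maxims l" "X \<in> maxims l \<Longrightarrow> least_max l \<subseteq> X"
    using I by auto
qed

lemma least_max_eqI:
  assumes "X \<in> maxims l" "\<And>Y. Y \<in> maxims l \<Longrightarrow> X \<subseteq> Y"
  shows "least_max l = X"
  using assms least_max_in least_max_subset by blast

text \<open>Passing from \<open>X \<inter> Y\<close> to \<open>X\<close> is worth at least \<open>l\<close> per element, since \<open>X\<close> is optimal for \<open>l\<close>; passing from
  \<open>Y\<close> to \<open>X \<union> Y\<close> is worth at most \<open>m\<close> per element, since \<open>Y\<close> is optimal for \<open>m\<close>. Both steps add the elements of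
  \<open>X - Y\<close>, and the second is worth at least as much as the first by supermodularity. As \<open>m < l\<close>, there
  are no such elements.\<close>

lemma maxims_nested:
  assumes "X \<in> maxims l" "Y \<in> maxims m" "m < l"
  shows "X \<subseteq> Y"
proof (rule ccontr)
  assume "\<not> X \<subseteq> Y"
  have F: "X \<in> finite_sets" "Y \<in> finite_sets" using assms by (auto simp: maxims_iff)
  have "card (X \<inter> Y) < card X"
    using \<open>\<not> X \<subseteq> Y\<close> finite_sets_finite[OF F(1)] by (intro psubset_card_mono) auto
  then have "(l - m) * real (card (X \<inter> Y)) < (l - m) * real (card X)"
    using \<open>m < l\<close> by (intro mult_strict_left_mono) auto
  moreover have "gain l (X \<inter> Y) \<le> gain l X" "gain m (X \<union> Y) \<le> gain m Y"
    using assms finite_sets_Int_Un[OF F] by (auto simp: maxims_iff)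
  ultimately show False
    using gain_supermodular[OF F, of m] by (simp add: gain_def algebra_simps)
qed

lemma least_max_antimono: "m \<le> l \<Longrightarrow> least_max l \<subseteq> least_max m"
  using maxims_nested[OF least_max_in least_max_in, of m l] by (cases "m = l") simp_all

lemma val_bounded: obtains M where "\<And>X. X \<in> finite_sets \<Longrightarrow> \<bar>val X\<bar> \<le> M"
proof
  show "\<bar>val X\<bar> \<le> (\<Sum>Y\<in>finite_sets. \<bar>val Y\<bar>)" if "X \<in> finite_sets" for X
    using that finite_finite_sets by (intro member_le_sum) auto
qed

text \<open>Once the penalty per element is at least every value of \<open>p\<close>, no nonempty set beats the empty set.\<close>

lemma least_max_eventually_empty: obtains l0 where "\<And>l. l \<ge> l0 \<Longrightarrow> least_max l = {}"
proof -
  obtain M where M: "\<And>X. X \<in> finite_sets \<Longrightarrow> \<bar>val X\<bar> \<le> M" using val_bounded by blast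
  have "M \<ge> 0" using M[OF empty_in_finite_sets] by simp
  have "least_max l = {}" if "l \<ge> M" for l
  proof (rule least_max_eqI)
    have "gain l Y \<le> gain l {}" if Y: "Y \<in> finite_sets" for Y
    proof (cases "Y = {}")
      case False
      then have "1 \<le> real (card Y)" using finite_sets_finite[OF Y] by (simp add: Suc_le_eq card_gt_0_iff)
      then have "l \<le> l * real (card Y)" using \<open>M \<ge> 0\<close> \<open>l \<ge> M\<close> by (simp add: mult_le_cancel_left1)
      then show ?thesis using M[OF Y] \<open>l \<ge> M\<close> by (simp add: gain_def val_empty)
    qed simp
    then show "{} \<in> maxims l" using empty_in_finite_sets by (simp add: maxims_iff)
  qed simp
  then show ?thesis using that by blast
qed

text \<open>Two values differ by at most \<open>2 * M\<close>, so a larger reward per element makes \<open>S\<close> the only maximizer.\<close>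

lemma least_max_eventually_full: obtains l0 where "\<And>l. l \<le> l0 \<Longrightarrow> least_max l = S"
proof -
  obtain M where M: "\<And>X. X \<in> finite_sets \<Longrightarrow> \<bar>val X\<bar> \<le> M" using val_bounded by blast
  have "M \<ge> 0" using M[OF empty_in_finite_sets] by simp
  have "least_max l = S" if l: "l \<le> - 2 * M - 1" for l
  proof (rule ccontr)
    assume "least_max l \<noteq> S"
    define X where "X = least_max l"
    have X: "X \<in> finite_sets" "gain l S \<le> gain l X"
      using least_max_in S_in_finite_sets by (auto simp: X_def maxims_iff)
    have "card X < card S"
      using \<open>least_max l \<noteq> S\<close> finite_S finite_sets_subset[OF X(1)]
      by (intro psubset_card_mono) (auto simp: X_def)
    then have "- l * 1 \<le> - l * (real (card S) - real (card X))"
      using l \<open>M \<ge> 0\<close> by (intro mult_left_mono) auto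
    then show False
      using X(2) l M[OF X(1)] M[OF S_in_finite_sets] by (simp add: gain_def algebra_simps)
  qed
  then show ?thesis using that by blast
qed

text \<open>Some maximizer, namely \<open>least_max l\<close>, is among the supersets of \<open>C\<close>, so optimality among these
  is optimality among all sets.\<close>

lemma maxims_if_max_above:
  assumes C: "C \<in> finite_sets" "C \<subseteq> least_max l"
    and above: "\<And>Y. Y \<in> finite_sets \<Longrightarrow> C \<subseteq> Y \<Longrightarrow> gain l Y \<le> gain l C"
  shows "C \<in> maxims l"
  using above[OF _ C(2)] least_max_in[of l] C(1) unfolding maxims_iff by (meson order_trans)

lemma critical_iff: "l \<in> crit \<longleftrightarrow> (\<exists>X\<in>maxims l. X \<noteq> least_max l)"
proof -
  have "l \<in> crit \<longleftrightarrow> \<not> is_singleton (maxims l)"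
  proof -
    have "0 < card (maxims l)" using finite_maxims maxims_nonempty by (simp add: card_gt_0_iff)
    then show ?thesis by (auto simp: critical_values_def is_singleton_altdef)
  qed
  also have "\<dots> \<longleftrightarrow> (\<exists>X\<in>maxims l. X \<noteq> least_max l)"
  proof
    assume "\<not> is_singleton (maxims l)"
    then have "maxims l \<noteq> {least_max l}" by (metis is_singletonI)
    then show "\<exists>X\<in>maxims l. X \<noteq> least_max l" using least_max_in[of l] by blast
  next
    assume "\<exists>X\<in>maxims l. X \<noteq> least_max l"
    then show "\<not> is_singleton (maxims l)"
      using least_max_in[of l] by (metis is_singletonE singletonD)
  qed
  finally show ?thesis .
qed

lemma gain_le_iff_slope:
  assumes "C \<subset> Y" "finite Y"
  shows "gain l Y \<le> gain l C \<longleftrightarrow> (val Y - val C) / real (card (Y - C)) \<le> l"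
proof -
  have c: "real (card (Y - C)) = real (card Y) - real (card C)"
    using assms by (metis card_Diff_subset card_mono finite_subset of_nat_diff psubset_imp_subset)
  have "card C < card Y" using assms by (simp add: psubset_card_mono)
  then have "0 < real (card (Y - C))" using c by simp
  then show ?thesis unfolding gain_def by (simp add: c field_simps)
qed

text \<open>A critical value has two nested maximizers, which separate \<open>L\<close> on its two sides. Conversely, let
  \<open>C = L(b)\<close> be smaller than \<open>L(a)\<close>. The largest slope \<open>(p(Y) - p(C)) / |Y - C|\<close> over the proper supersets \<open>Y\<close> of \<open>C\<close> is
  the value \<open>l\<close> at which \<open>C\<close> is about to lose its optimality: there \<open>C\<close> and the steepest \<open>Y\<close> tie, so \<open>l\<close> is critical.
  It is at most \<open>b\<close>, where \<open>C\<close> is optimal, and greater than \<open>a\<close>, where it is not.\<close>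

lemma jump_iff_critical:
  assumes "a \<le> b"
  shows "least_max a \<noteq> least_max b \<longleftrightarrow> (\<exists>l\<in>crit. a < l \<and> l \<le> b)"
proof
  assume "\<exists>l\<in>crit. a < l \<and> l \<le> b"
  then obtain l X where l: "a < l" "l \<le> b" and X: "X \<in> maxims l" "X \<noteq> least_max l"
    unfolding Bex_def critical_iff by blast
  have "least_max b \<subseteq> least_max l" using l by (simp add: least_max_antimono)
  moreover have "least_max l \<subset> X" using X least_max_subset by blast
  moreover have "X \<subseteq> least_max a" by (rule maxims_nested[OF X(1) least_max_in l(1)])
  ultimately show "least_max a \<noteq> least_max b" by blast
next
  assume ne: "least_max a \<noteq> least_max b"
  define C where "C = least_max b"
  have C: "C \<in> maxims b" "C \<in> finite_sets" using least_max_in by (auto simp: C_def maxims_iff)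
  have CA: "C \<subset> least_max a" using ne least_max_antimono[OF assms] by (auto simp: C_def)
  have AF: "least_max a \<in> finite_sets" using least_max_in by (simp add: maxims_iff)
  define slope where "slope = (\<lambda>Y. (val Y - val C) / real (card (Y - C)))"
  define A where "A = {Y \<in> finite_sets. C \<subset> Y}"
  have A: "finite A" "A \<noteq> {}" using finite_finite_sets CA AF by (auto simp: A_def)
  obtain Y where Y: "Y \<in> A" "\<And>Z. Z \<in> A \<Longrightarrow> slope Z \<le> slope Y"
    using ex_is_arg_min_if_finite[OF A, of "\<lambda>Y. - slope Y"] by (auto simp: is_arg_min_linorder)
  have slope: "gain l Z \<le> gain l C \<longleftrightarrow> slope Z \<le> l" if "Z \<in> A" for l Z
    using that gain_le_iff_slope finite_sets_finite by (simp add: A_def slope_def)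
  have max: "C \<in> maxims l" if "slope Y \<le> l" "l \<le> b" for l
  proof (rule maxims_if_max_above[OF C(2)])
    show "gain l Z \<le> gain l C" if "Z \<in> finite_sets" "C \<subseteq> Z" for Z
    proof (cases "Z = C")
      case False
      then have "Z \<in> A" using that by (auto simp: A_def)
      then show ?thesis using slope[of Z l] Y(2)[of Z] \<open>slope Y \<le> l\<close> by linarith
    qed simp
    show "C \<subseteq> least_max l" unfolding C_def using \<open>l \<le> b\<close> by (rule least_max_antimono)
  qed
  have "slope Y \<le> b" using slope[OF Y(1), of b] C(1) Y(1) by (auto simp: maxims_iff A_def)
  moreover have "a < slope Y"
  proof (rule ccontr)
    assume "\<not> a < slope Y"
    then have "C \<in> maxims a" using max[of a] assms by simp
    then show False using CA least_max_subset by blast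
  qed
  moreover have "slope Y \<in> crit"
  proof -
    have Cl: "C \<in> maxims (slope Y)" by (rule max) (use \<open>slope Y \<le> b\<close> in auto)
    have YA: "Y \<in> finite_sets" "C \<subset> Y" using Y(1) by (auto simp: A_def)
    have "gain (slope Y) C \<le> gain (slope Y) Y"
    proof -
      have "card C < card Y" using YA finite_sets_finite by (simp add: psubset_card_mono)
      moreover have "real (card (Y - C)) = real (card Y) - real (card C)"
        using YA finite_sets_finite[OF YA(1)]
        by (metis card_Diff_subset card_mono finite_subset of_nat_diff psubset_imp_subset)
      ultimately have "slope Y * (real (card Y) - real (card C)) = val Y - val C"
        by (simp add: slope_def)
      then show ?thesis by (simp add: gain_def algebra_simps)
    qed
    then have "Y \<in> maxims (slope Y)" using Cl YA(1) unfolding maxims_iff by (meson order_trans)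
    moreover have "Y \<noteq> least_max (slope Y)" using least_max_subset[OF Cl] YA(2) by blast
    ultimately show ?thesis using critical_iff by blast
  qed
  ultimately show "\<exists>l\<in>crit. a < l \<and> l \<le> b" by blast
qed

text \<open>\<open>L\<close> jumps at each critical value, so it is injective on them.\<close>

lemma finite_crit: "finite crit"
proof (rule inj_on_finite)
  show "inj_on least_max crit"
  proof (rule linorder_inj_onI)
    fix l m assume "l < m" "l \<in> crit" "m \<in> crit"
    then show "least_max l \<noteq> least_max m" using jump_iff_critical[of l m] by auto
  qed auto
  show "least_max ` crit \<subseteq> finite_sets" using least_max_in by (auto simp: maxims_iff)
qed (rule finite_finite_sets)

section \<open>The principal chain\<close>

abbreviation r :: nat where "r \<equiv> num_critical S p"
abbreviation crit_val :: "nat \<Rightarrow> real" where "crit_val \<equiv> critical_value S p"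

lemma crit_val_strict: 
  assumes "1 \<le> i" "i < j" "j \<le> r"
  shows "crit_val j < crit_val i"
proof -
  let ?xs = "sorted_list_of_set crit"
  have len: "length ?xs = r" by (simp add: num_critical_def)
  have "?xs ! (r - j) < ?xs ! (r - i)"
    using assms len strict_sorted_list_of_set[of crit]
    by (intro sorted_wrt_nth_less[of "(<)"]) auto
  moreover have "crit_val k = ?xs ! (r - k)" if "1 \<le> k" "k \<le> r" for k
    using that len by (simp add: critical_value_def rev_nth)
  ultimately show ?thesis using assms by simp
qed

lemma crit_val_image: "crit_val ` {1..r} = crit"
proof -
  let ?xs = "rev (sorted_list_of_set crit)"
  have "crit = set ?xs" using finite_crit by simp
  also have "\<dots> = (\<lambda>i. ?xs ! i) ` {0..<r}"
    unfolding set_conv_nth by (auto simp: num_critical_def)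
  also have "\<dots> = (\<lambda>i. ?xs ! (i - 1)) ` Suc ` {0..<r}" unfolding image_image by simp
  also have "Suc ` {0..<r} = {1..r}" by (simp add: atLeastLessThanSuc_atLeastAtMost)
  finally show ?thesis by (simp add: critical_value_def)
qed

definition num_above :: "real \<Rightarrow> nat" where "num_above l = card {c \<in> crit. l < c}"

lemma num_above_le: "num_above l \<le> r"
  unfolding num_above_def num_critical_def using finite_crit by (intro card_mono) auto

text \<open>The critical values are listed in decreasing order, so those above \<open>l\<close> occupy an initial
  segment of the indices.\<close>

lemma crit_val_gt_iff:
  assumes "i \<in> {1..r}"
  shows "l < crit_val i \<longleftrightarrow> i \<le> num_above l"
proof -
  define I where "I = {i \<in> {1..r}. l < crit_val i}"
  have down: "k \<in> I" if "j \<in> I" "1 \<le> k" "k \<le> j" for j k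
    using that crit_val_strict[of k j] by (cases "k = j") (auto simp: I_def)
  have fin: "finite I" by (simp add: I_def)
  have "\<exists>n. I = {1..n}"
  proof (cases "I = {}")
    case False
    have "I = {1..Max I}"
    proof (intro equalityI subsetI)
      show "k \<in> {1..Max I}" if "k \<in> I" for k
        using that Max_ge[OF fin that] by (auto simp: I_def)
      show "k \<in> I" if "k \<in> {1..Max I}" for k
        using that down[OF Max_in[OF fin False]] by simp
    qed
    then show ?thesis by blast
  qed (auto intro: exI[of _ 0])
  then obtain n where n: "I = {1..n}" ..
  have "inj_on crit_val {1..r}"
    by (rule linorder_inj_onI) (use crit_val_strict in fastforce)+
  then have "inj_on crit_val I" by (rule inj_on_subset) (auto simp: I_def)
  moreover have "{c \<in> crit. l < c} = crit_val ` I" unfolding crit_val_image[symmetric] by (auto simp: I_def)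
  ultimately have "num_above l = n" by (simp add: num_above_def card_image n)
  then have "i \<in> I \<longleftrightarrow> i \<le> num_above l" using assms n by simp
  then show ?thesis using assms by (simp add: I_def)
qed

abbreviation crit_level :: "nat \<Rightarrow> 'a set" where "crit_level \<equiv> critical_level_set S p"

text \<open>Below \<open>l\<close>, no jump occurs before the next critical value; if there is none, \<open>L\<close> already has its final value \<open>S\<close>,
  in accordance with the convention for the last level set.\<close>

lemma least_max_eq_crit_level: "least_max l = crit_level (Suc (num_above l))"
proof (cases "num_above l = r")
  case True
  obtain l0 where l0: "\<And>m. m \<le> l0 \<Longrightarrow> least_max m = S"
    using least_max_eventually_full by blast
  have "\<not> c \<le> l" if "c \<in> crit" for c
    using that crit_val_gt_iff[of _ l] True crit_val_image by (force simp: image_iff)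
  then have "least_max (min l l0) = least_max l"
    using jump_iff_critical[of "min l l0" l] by auto
  then show ?thesis using l0[of "min l l0"] True by (simp add: critical_level_set_def)
next
  case False
  define k where "k = Suc (num_above l)"
  have k: "k \<in> {1..r}" using False num_above_le[of l] by (simp add: k_def)
  have "crit_val k \<le> l" using crit_val_gt_iff[OF k, of l] by (simp add: k_def)
  moreover have "\<not> (crit_val k < c \<and> c \<le> l)" if c: "c \<in> crit" for c
  proof -
    obtain i where i: "i \<in> {1..r}" "c = crit_val i" using c crit_val_image by blast
    show ?thesis
    proof (cases "i < k")
      case True
      then show ?thesis using crit_val_gt_iff[OF i(1), of l] i by (simp add: k_def)
    next
      case False
      then show ?thesis using crit_val_strict[of k i] i k by (cases "i = k") auto
    qed
  qed
  ultimately have "least_max (crit_val k) = least_max l"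
    using jump_iff_critical[of "crit_val k" l] by blast
  then show ?thesis using k by (simp add: critical_level_set_def k_def)
qed

lemma crit_level_mono:
  assumes "1 \<le> i" "i \<le> j"
  shows "crit_level i \<subseteq> crit_level j"
proof -
  have "least_max l \<subseteq> S" for l using least_max_in finite_sets_subset maxims_iff by blast
  moreover have "least_max (crit_val i) \<subseteq> least_max (crit_val j)" if "j \<le> r"
    using that assms crit_val_strict[of i j] by (cases "i = j") (auto intro!: least_max_antimono)
  ultimately show ?thesis using assms by (auto simp: critical_level_set_def)
qed

lemma crit_level_1: "crit_level 1 = {}"
proof -
  obtain l0 where l0: "\<And>m. m \<ge> l0 \<Longrightarrow> least_max m = {}"
    using least_max_eventually_empty by blast
  have "crit_level 1 \<subseteq> crit_level (Suc (num_above l0))" by (rule crit_level_mono) auto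
  then show ?thesis using l0[of l0] least_max_eq_crit_level[of l0] by simp
qed

text \<open>The parts are differences of an increasing sequence that starts at \<open>{}\<close>, so their unions telescope.\<close>

lemma principal_chain_eq_crit_level: "principal_chain S p k = crit_level (Suc k)"
proof (induction k)
  case 0
  then show ?case using crit_level_1 by (simp add: principal_chain_def)
next
  case (Suc k)
  have "principal_chain S p (Suc k) = principal_chain S p k \<union> principal_part S p (Suc k)"
    by (auto simp: principal_chain_def atLeastAtMostSuc_conv)
  then show ?case
    using Suc crit_level_mono[of "Suc k" "Suc (Suc k)"] by (auto simp: principal_part_def)
qed

lemma least_max_eq_principal_chain: "least_max l = principal_chain S p (num_above l)"
  by (simp add: least_max_eq_crit_level principal_chain_eq_crit_level)

lemma principal_chain_diff:
  assumes "k0 \<le> k"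
  shows "principal_chain S p k - principal_chain S p k0 = (\<Union>i\<in>{k0<..k}. principal_part S p i)"
proof -
  have "principal_chain S p k = principal_chain S p k0 \<union> (\<Union>i\<in>{k0<..k}. principal_part S p i)"
  proof -
    have "{1..k} = {1..k0} \<union> {k0<..k}" using assms by auto
    then show ?thesis by (simp add: principal_chain_def UN_Un)
  qed
  moreover have "principal_part S p i \<inter> principal_chain S p k0 = {}" if "i \<in> {k0<..k}" for i
    using that crit_level_mono[of "Suc k0" i] by (auto simp: principal_chain_eq_crit_level principal_part_def)
  ultimately show ?thesis by blast
qed

section \<open>The canonical chain\<close>

text \<open>The step value is the maximum of rounded-up slopes, and a slope rounds up to at most the integer
  \<open>k\<close> iff it is at most \<open>k\<close>, that is, iff the corresponding superset does not beat \<open>C\<close> at \<open>k\<close>.\<close>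

lemma step_value_le_iff:
  assumes C: "C \<in> finite_sets" "C \<noteq> S"
  shows "step_value S p C \<le> k \<longleftrightarrow>
    (\<forall>Y\<in>finite_sets. C \<subseteq> Y \<longrightarrow> gain (of_int k) Y \<le> gain (of_int k) C)"
proof -
  define A where "A = {Y \<in> finite_sets. C \<subset> Y}"
  define slope where "slope = (\<lambda>Y. (val Y - val C) / real (card (Y - C)))"
  have A: "finite A" "A \<noteq> {}"
    using finite_finite_sets S_in_finite_sets C finite_sets_subset[OF C(1)] by (auto simp: A_def)
  have "{\<lceil>real_of_ereal (p (X \<union> C) - p C) / real (card X)\<rceil> | X.
            X \<noteq> {} \<and> X \<subseteq> S - C \<and> p (X \<union> C) \<noteq> -\<infinity>} = (\<lambda>Y. \<lceil>slope Y\<rceil>) ` A" (is "?L = _")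
  proof (intro equalityI subsetI)
    fix z assume "z \<in> ?L"
    then obtain X where X: "X \<noteq> {}" "X \<subseteq> S - C" "p (X \<union> C) \<noteq> -\<infinity>"
      and z: "z = \<lceil>real_of_ereal (p (X \<union> C) - p C) / real (card X)\<rceil>" by blast
    have "X \<union> C \<subseteq> S" using X(2) finite_sets_subset[OF C(1)] by blast
    then have F: "X \<union> C \<in> finite_sets" using X(3) by (simp add: finite_sets_def)
    then have "X \<union> C \<in> A" using X by (auto simp: A_def)
    moreover have "X \<union> C - C = X" using X by blast
    ultimately show "z \<in> (\<lambda>Y. \<lceil>slope Y\<rceil>) ` A"
      using z by (intro image_eqI[of _ _ "X \<union> C"])
        (simp_all add: slope_def p_eq_val[OF F] p_eq_val[OF C(1)])
  next
    fix z assume "z \<in> (\<lambda>Y. \<lceil>slope Y\<rceil>) ` A"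
    then obtain Y where Y: "Y \<in> finite_sets" "C \<subset> Y" "z = \<lceil>slope Y\<rceil>" by (auto simp: A_def)
    have "Y - C \<union> C = Y" using Y by blast
    then show "z \<in> ?L"
      using Y finite_sets_subset[OF Y(1)]
      by (intro CollectI exI[of _ "Y - C"])
        (auto simp: slope_def p_eq_val[OF Y(1)] p_eq_val[OF C(1)])
  qed
  then have "step_value S p C = Max ((\<lambda>Y. \<lceil>slope Y\<rceil>) ` A)" by (simp add: step_value_def)
  then have "step_value S p C \<le> k \<longleftrightarrow> (\<forall>Y\<in>A. slope Y \<le> of_int k)"
    using A by (simp add: ceiling_le_iff)
  also have "\<dots> \<longleftrightarrow> (\<forall>Y\<in>A. gain (of_int k) Y \<le> gain (of_int k) C)"
    using gain_le_iff_slope finite_sets_finite by (auto simp: A_def slope_def)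
  also have "\<dots> \<longleftrightarrow> (\<forall>Y\<in>finite_sets. C \<subseteq> Y \<longrightarrow> gain (of_int k) Y \<le> gain (of_int k) C)"
    by (auto simp: A_def)
  finally show ?thesis .
qed

text \<open>Every maximizer at an integer \<open>k \<le> b\<close> contains \<open>C\<close>, so the optimality of \<open>C\<close> among its supersets that
  characterizes \<open>\<beta> \<le> k\<close> amounts to \<open>L(k) = C\<close>. In the same way, the maximization over \<open>S - C\<close> that defines the
  step part is the global maximization at \<open>\<beta> - 1\<close> with \<open>C\<close> removed from the sets.\<close>

lemma canonical_step:
  fixes b :: int
  assumes Cb: "C = least_max b" and "C \<noteq> S"
  defines "\<beta> \<equiv> step_value S p C"
  shows "\<beta> \<le> b" "least_max \<beta> = C" "C \<subset> least_max (\<beta> - 1)"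
    "step_part S p C = least_max (\<beta> - 1) - C"
proof -
  have Cm: "C \<in> maxims b" unfolding Cb by (rule least_max_in)
  then have C: "C \<in> finite_sets" by (simp add: maxims_iff)
  have le_iff: "\<beta> \<le> k \<longleftrightarrow> least_max (of_int k) = C" if "k \<le> b" for k
  proof -
    have sub: "C \<subseteq> least_max (of_int k)" unfolding Cb using that by (intro least_max_antimono) simp
    have "C \<in> maxims (of_int k)" if "\<beta> \<le> k"
      using that step_value_le_iff[OF C \<open>C \<noteq> S\<close>] by (intro maxims_if_max_above[OF C sub]) (auto simp: \<beta>_def)
    then have "\<beta> \<le> k \<longleftrightarrow> C \<in> maxims (of_int k)"
      using step_value_le_iff[OF C \<open>C \<noteq> S\<close>, of k] by (auto simp: \<beta>_def maxims_iff)
    also have "\<dots> \<longleftrightarrow> least_max (of_int k) = C"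
      using sub least_max_in least_max_subset by blast
    finally show ?thesis .
  qed
  show b: "\<beta> \<le> b" using le_iff[of b] Cb by simp
  show "least_max \<beta> = C" using le_iff[OF b] by simp
  define D where "D = least_max (\<beta> - 1)"
  have sub: "C \<subseteq> D" unfolding Cb D_def using b by (intro least_max_antimono) simp
  moreover have "D \<noteq> C" using le_iff[of "\<beta> - 1"] b by (auto simp: D_def)
  ultimately show "C \<subset> least_max (\<beta> - 1)" by (auto simp: D_def)
  \<comment> \<open>On sets \<open>X\<close> disjoint from \<open>C\<close>, the step objective is the gain at \<open>\<beta> - 1\<close> of \<open>X \<union> C\<close>, shifted by a constant.\<close>
  let ?h = "\<lambda>X. p (X \<union> C) - ereal (of_int (\<beta> - 1) * real (card X)) - p C"
  let ?s = "\<lambda>X. gain (of_int (\<beta> - 1)) (X \<union> C) - gain (of_int (\<beta> - 1)) C"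
  have h: "?h X = ereal (?s X)" if "X \<subseteq> S - C" "X \<union> C \<in> finite_sets" for X
  proof -
    have "card (X \<union> C) = card X + card C"
      using that finite_S finite_sets_finite[OF C]
      by (intro card_Un_disjoint) (auto intro: finite_subset)
    then show ?thesis
      by (simp add: p_eq_val[OF that(2)] p_eq_val[OF C] gain_def algebra_simps)
  qed
  have hinf: "?h X = -\<infinity>" if "X \<subseteq> S - C" "X \<union> C \<notin> finite_sets" for X
  proof -
    have "X \<union> C \<subseteq> S" using that finite_sets_subset[OF C] by blast
    then show ?thesis using that p_eq_val[OF C] by (simp add: finite_sets_def)
  qed
  have "smallest_maximizer (S - C) ?h = D - C"
    unfolding smallest_maximizer_def
  proof (rule Least_equality)
    have Dm: "D \<in> maxims (of_int (\<beta> - 1))" unfolding D_def using least_max_in[of "of_int (\<beta> - 1)"] by simp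
    then have D: "D \<in> finite_sets" by (simp add: maxims_iff)
    have DC: "D - C \<union> C = D" using sub by blast
    have DS: "D - C \<subseteq> S - C" using finite_sets_subset[OF D] by blast
    have hD: "?h (D - C) = ereal (?s (D - C))" by (rule h) (use DS D DC in auto)
    have "?h Y \<le> ?h (D - C)" if "Y \<subseteq> S - C" for Y
    proof (cases "Y \<union> C \<in> finite_sets")
      case True
      then show ?thesis unfolding h[OF that True] hD using Dm by (simp only: DC maxims_iff ereal_less_eq) simp
    next
      case False
      then show ?thesis unfolding hinf[OF that False] by simp
    qed
    then show "D - C \<in> maximizers (S - C) ?h" using DS by (simp add: maximizers_def)
    show "D - C \<subseteq> X" if X: "X \<in> maximizers (S - C) ?h" for X
    proof -
      have "X \<subseteq> S - C \<and> (\<forall>Y\<subseteq>S - C. ?h Y \<le> ?h X)"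
        using X unfolding maximizers_def by (rule CollectD)
      then have XS: "X \<subseteq> S - C" and le: "?h (D - C) \<le> ?h X" using DS by blast+
      have F: "X \<union> C \<in> finite_sets"
      proof (rule ccontr)
        assume "X \<union> C \<notin> finite_sets"
        then show False using le unfolding hinf[OF XS \<open>X \<union> C \<notin> finite_sets\<close>] hD by simp
      qed
      have "gain (of_int (\<beta> - 1)) D \<le> gain (of_int (\<beta> - 1)) (X \<union> C)"
        using le unfolding h[OF XS F] hD unfolding DC ereal_less_eq by linarith
      then have "X \<union> C \<in> maxims (of_int (\<beta> - 1))"
        using Dm F unfolding maxims_iff by (meson order_trans)
      then have "D \<subseteq> X \<union> C" using least_max_subset by (simp add: D_def)
      then show ?thesis by blast
    qed
  qed
  then show "step_part S p C = least_max (\<beta> - 1) - C"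
    by (simp add: step_part_def D_def \<beta>_def)
qed

abbreviation canon :: "nat \<Rightarrow> 'a set" where "canon \<equiv> canonical_chain S p"
abbreviation ess_val :: "nat \<Rightarrow> int" where "ess_val \<equiv> essential_value S p"
abbreviation q :: nat where "q \<equiv> num_essential S p"

text \<open>The invariant needed to apply \<open>canonical_step\<close> repeatedly; it starts because \<open>L\<close> is empty at large integers.\<close>

lemma canonical_chain_level:
  assumes "\<forall>i<j. canon i \<noteq> S"
  shows "\<exists>b::int. canon j = least_max b"
  using assms
proof (induction j)
  case 0
  obtain l0 where l0: "\<And>m. m \<ge> l0 \<Longrightarrow> least_max m = {}"
    using least_max_eventually_empty by blast
  then show ?case by (intro exI[of _ "\<lceil>l0\<rceil>"]) simp
next
  case (Suc j)
  then obtain b :: int where "canon j = least_max b" by auto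
  from canonical_step[OF this] Suc.prems
  have "canon (Suc j) = least_max (of_int (step_value S p (canon j) - 1))" by auto
  then show ?case by blast
qed

lemma canonical_chain_step:
  assumes "\<forall>i\<le>j. canon i \<noteq> S"
  shows "canon j = least_max (ess_val (Suc j))" "canon (Suc j) = least_max (ess_val (Suc j) - 1)"
    "canon j \<subset> canon (Suc j)" "canonical_part S p (Suc j) = canon (Suc j) - canon j"
proof -
  obtain b :: int where b: "canon j = least_max b" using canonical_chain_level[of j] assms by auto
  have "canon j \<noteq> S" using assms by blast
  note step = canonical_step[OF b this]
  show "canon j = least_max (ess_val (Suc j))" "canon (Suc j) = least_max (ess_val (Suc j) - 1)"
    "canon j \<subset> canon (Suc j)" "canonical_part S p (Suc j) = canon (Suc j) - canon j"
    using step by (auto simp: essential_value_def canonical_part_def)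
qed

lemma canonical_chain_reaches_S: "\<exists>q. canon q = S"
proof (rule ccontr)
  assume "\<not> ?thesis"
  then have ne: "\<forall>i\<le>j. canon i \<noteq> S" for j by blast
  have fin: "canon j \<subseteq> S" for j
    using canonical_chain_step(1)[OF ne] least_max_in maxims_iff finite_sets_subset by metis
  have "j \<le> card (canon j)" for j
  proof (induction j)
    case (Suc j)
    have "card (canon j) < card (canon (Suc j))"
      using canonical_chain_step(3)[OF ne] fin finite_S by (meson finite_subset psubset_card_mono)
    then show ?case using Suc by simp
  qed simp
  then have "Suc (card S) \<le> card (canon (Suc (card S)))" .
  also have "\<dots> \<le> card S" by (rule card_mono[OF finite_S fin])
  finally show False by simp
qed

lemma canonical_chain_num_essential: "canon q = S"
  unfolding num_essential_def using canonical_chain_reaches_S by (rule LeastI_ex)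

lemma canonical_chain_props:
  assumes "j \<in> {1..q}"
  shows "canon (j - 1) = least_max (ess_val j)" "canon j = least_max (ess_val j - 1)"
    "canon (j - 1) \<subset> canon j" "canonical_part S p j = canon j - canon (j - 1)"
proof -
  obtain i where j: "j = Suc i" using assms by (cases j) auto
  have "\<forall>k\<le>i. canon k \<noteq> S"
    using assms not_less_Least[of _ "\<lambda>q. canon q = S"] by (auto simp: j num_essential_def)
  from canonical_chain_step[OF this]
  show "canon (j - 1) = least_max (ess_val j)" "canon j = least_max (ess_val j - 1)"
    "canon (j - 1) \<subset> canon j" "canonical_part S p j = canon j - canon (j - 1)"
    by (simp_all add: j)
qed

text \<open>For the converse direction, consider the first chain member \<open>C\<^sub>j\<close> that contains \<open>L(b - 1)\<close>. Since \<open>C\<^bsub>j-1\<^esub> = L(\<beta>\<^sub>j)\<close>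
  does not contain it, \<open>b \<le> \<beta>\<^sub>j\<close>. If \<open>b \<le> \<beta>\<^sub>j - 1\<close>, then \<open>L(b)\<close> would contain \<open>L(\<beta>\<^sub>j - 1) = C\<^sub>j\<close> and hence \<open>L(b - 1)\<close>, so
  there would be no jump.\<close>

lemma essential_value_iff_jump:
  fixes b :: int
  shows "b \<in> ess_val ` {1..q} \<longleftrightarrow> least_max (of_int b - 1) \<noteq> least_max b"
proof
  assume "b \<in> ess_val ` {1..q}"
  then show "least_max (of_int b - 1) \<noteq> least_max b" using canonical_chain_props by fastforce
next
  assume jump: "least_max (of_int b - 1) \<noteq> least_max b"
  define j where "j = (LEAST j. least_max (of_int b - 1) \<subseteq> canon j)"
  have ex: "least_max (of_int b - 1) \<subseteq> canon q"
    using canonical_chain_num_essential least_max_in maxims_iff finite_sets_subset by blast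
  have sub: "least_max (of_int b - 1) \<subseteq> canon j" and "j \<le> q"
    unfolding j_def using ex by (rule LeastI, rule Least_le)
  have b: "least_max b \<subset> least_max (of_int b - 1)"
    using jump least_max_antimono[of "of_int b - 1" b] by auto
  then have "j \<noteq> 0" using sub by (cases j) auto
  then have j: "j \<in> {1..q}" using \<open>j \<le> q\<close> by simp
  note props = canonical_chain_props[OF j]
  have "\<not> least_max (of_int b - 1) \<subseteq> least_max (ess_val j)"
    using not_less_Least[of "j - 1" "\<lambda>j. least_max (of_int b - 1) \<subseteq> canon j"] \<open>j \<noteq> 0\<close> props(1)
    by (simp add: j_def)
  then have "\<not> of_int (ess_val j) \<le> of_int b - (1 :: real)" using least_max_antimono by blast
  moreover have "\<not> b \<le> ess_val j - 1"
  proof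
    assume "b \<le> ess_val j - 1"
    then have "least_max (ess_val j - 1) \<subseteq> least_max b" by (intro least_max_antimono) simp
    then show False using sub b props(2) by simp
  qed
  ultimately have "b = ess_val j" by linarith
  then show "b \<in> ess_val ` {1..q}" using j by blast
qed

section \<open>Comparison of the two partitions\<close>

lemma essential_value_iff_critical:
  fixes b :: int
  shows "b \<in> ess_val ` {1..q} \<longleftrightarrow> (\<exists>l\<in>crit. of_int b \<ge> l \<and> l > of_int b - 1)"
  using essential_value_iff_jump[of b] jump_iff_critical[of "of_int b - 1" "of_int b"] by auto

lemma essential_value_strict_antimono: "strict_antimono_on {1..q} ess_val"
proof (rule monotone_onI)
  fix i j assume ij: "i \<in> {1..q}" "j \<in> {1..q}" "i < j"
  have "canon i \<subseteq> canon (j - 1)"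
    by (rule lift_Suc_mono_le[of canon]) (use ij in auto)
  then have "\<not> least_max (ess_val j) \<subseteq> least_max (ess_val i)"
    using canonical_chain_props(1,3)[OF ij(1)] canonical_chain_props(1)[OF ij(2)] by auto
  then show "ess_val i > ess_val j" using least_max_antimono[of "ess_val i" "ess_val j"] by force
qed

text \<open>A critical value rounds up to \<open>\<beta>\<^sub>j\<close> iff it is above \<open>\<beta>\<^sub>j - 1\<close> but not above \<open>\<beta>\<^sub>j\<close>, and counting the critical
  values above a number locates it in their list. The strict inequality makes the set of indices nonempty, so that
  its maximum is meaningful.\<close>

lemma aggregation_indices_eq:
  assumes "j \<in> {1..q}"
  shows "aggregation_indices S p j = {num_above (ess_val j)<..num_above (ess_val j - 1)}"
    and "num_above (ess_val j) < num_above (ess_val j - 1)"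
proof -
  have ceil: "\<lceil>x\<rceil> = b \<longleftrightarrow> of_int b - 1 < x \<and> \<not> of_int b < x" for x :: real and b
    by (auto simp: ceiling_eq_iff)
  show I: "aggregation_indices S p j = {num_above (ess_val j)<..num_above (ess_val j - 1)}"
    using num_above_le[of "ess_val j - 1"]
    by (auto simp: aggregation_indices_def ceil crit_val_gt_iff)
  obtain l where "l \<in> crit" "of_int (ess_val j) \<ge> l" "l > of_int (ess_val j) - 1"
    using essential_value_iff_critical[of "ess_val j"] assms by blast
  then obtain i where "i \<in> aggregation_indices S p j"
    using crit_val_image by (force simp: aggregation_indices_def ceil)
  then show "num_above (ess_val j) < num_above (ess_val j - 1)" using I by auto
qed

lemma canonical_part_eq:
  assumes "j \<in> {1..q}"
  shows "canonical_part S p j = (\<Union>i\<in>aggregation_indices S p j. principal_part S p i)"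
  using canonical_chain_props[OF assms] aggregation_indices_eq[OF assms]
  by (simp add: least_max_eq_principal_chain principal_chain_diff)

lemma canonical_chain_eq:
  assumes "j \<in> {1..q}"
  shows "canon j = principal_chain S p (Max (aggregation_indices S p j))"
proof -
  have "Max {num_above (ess_val j)<..num_above (ess_val j - 1)} = num_above (ess_val j - 1)"
    by (rule Max_eqI) (use aggregation_indices_eq(2)[OF assms] in auto)
  then show ?thesis
    using canonical_chain_props(2)[OF assms] aggregation_indices_eq(1)[OF assms]
    by (simp add: least_max_eq_principal_chain)
qed

lemma ceiling_crit_val_antimono: "antimono_on {1..r} (\<lambda>i. \<lceil>crit_val i\<rceil>)"
proof (rule monotone_onI)
  fix i j assume "i \<in> {1..r}" "j \<in> {1..r}" "i \<le> j"
  then show "\<lceil>crit_val i\<rceil> \<ge> \<lceil>crit_val j\<rceil>"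
    using crit_val_strict[of i j] by (cases "i = j") (auto intro: ceiling_mono)
qed

lemma essential_values_eq_ceilings: "ess_val ` {1..q} = (\<lambda>i. \<lceil>crit_val i\<rceil>) ` {1..r}"
proof -
  have "(\<lambda>i. \<lceil>crit_val i\<rceil>) ` {1..r} = ceiling ` crit"
    by (simp add: crit_val_image[symmetric] image_image)
  moreover have "b \<in> ess_val ` {1..q} \<longleftrightarrow> b \<in> ceiling ` crit" for b
  proof -
    have "b \<in> ess_val ` {1..q} \<longleftrightarrow> (\<exists>l\<in>crit. \<lceil>l\<rceil> = b)"
      unfolding essential_value_iff_critical ceiling_eq_iff by blast
    also have "\<dots> \<longleftrightarrow> b \<in> ceiling ` crit" by auto
    finally show ?thesis .
  qed
  ultimately show ?thesis by (intro set_eqI) (simp only:)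
qed

end

theorem theorem3p9:
  fixes S :: "'a set" and p :: "'a set \<Rightarrow> ereal" and B :: "('a \<Rightarrow> real) set"
  assumes "finite S" and "S \<noteq> {}"
    and "integer_valued_on S p" and "supermodular_on S p"
    and "p {} = 0" and "p S \<noteq> -\<infinity>"
    and "B = base_polyhedron S p"
  shows
    "(strict_antimono_on {1..num_essential S p} (essential_value S p) \<and>
      antimono_on {1..num_critical S p} (\<lambda>i. \<lceil>critical_value S p i\<rceil>) \<and>
      essential_value S p ` {1..num_essential S p} =
        (\<lambda>i. \<lceil>critical_value S p i\<rceil>) ` {1..num_critical S p} \<and>
      (\<forall>b::int. b \<in> essential_value S p ` {1..num_essential S p} \<longleftrightarrow>
         (\<exists>l\<in>critical_values S p. of_int b \<ge> l \<and> l > of_int b - 1)))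
     \<and>
     (\<forall>j\<in>{1..num_essential S p}.
        canonical_part S p j = (\<Union>i\<in>aggregation_indices S p j. principal_part S p i))
     \<and>
     (\<forall>j\<in>{1..num_essential S p}.
        canonical_chain S p j = principal_chain S p (Max (aggregation_indices S p j)))"
proof -
  interpret integral_supermodular S p
    using assms by unfold_locales
  show ?thesis
    by (intro conjI allI ballI essential_value_strict_antimono ceiling_crit_val_antimono
        essential_values_eq_ceilings essential_value_iff_critical canonical_part_eq
        canonical_chain_eq)
qed

end
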